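(* Let $n\geq 1$, let $a,b$ be integers (possibly depending on $n$) with $0\leq b<a\leq n$, and let $g=a-b$. Consider the promise problem: given quantum oracle access to two strings $x,y\in\{0,1\}^n$, with the promise that either $h(x,y)\geq a$ or $h(x,y)\leq b$, decide which of the two cases holds. Any bounded-error quantum query algorithm solving this problem makes at least $\Omega(\sqrt{n/g})$ quantum oracle queries.
   Context: $h(x,y)$ denotes the Hamming distance between $x$ and $y$, i.e. the number of positions $i\in\{1,\dots,n\}$ with $x_i\neq y_i$. "Bounded-error" means the algorithm outputs the correct answer with probability at least $2/3$ on every input satisfying the promise. The query complexity is measured in the standard quantum query (oracle) model, where the algorithm accesses the bits of $x$ and $y$ only through queries to a quantum oracle. *)

theory Defs
  imports Complex_Main "Jordan_Normal_Form.Schur_Decomposition"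
begin

definition bit_strings :: "nat \<Rightarrow> bool list set" where
  "bit_strings n = {x. length x = n}"

definition hamming :: "bool list \<Rightarrow> bool list \<Rightarrow> nat" where
  "hamming x y = card {i. i < length x \<and> x ! i \<noteq> y ! i}"

definition unitary_mat :: "nat \<Rightarrow> complex mat \<Rightarrow> bool" where
  "unitary_mat N U \<longleftrightarrow>
     U \<in> carrier_mat N N \<and> mat_adjoint U * U = 1\<^sub>m N \<and> U * mat_adjoint U = 1\<^sub>m N"

text \<open>
  The state space for input length \<open>n\<close> and workspace dimension \<open>m\<close> is spanned by the
  basis states \<open>|j, b, w\<rangle>\<close>, where \<open>j < 2 * n\<close> is the query register,
  \<open>b\<close> the answer qubit and \<open>w < m\<close> the workspace. These are numbered
  by \<open>basis_index\<close>, a bijection onto \<open>{0..<2 * n * 2 * m}\<close>.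
\<close>

definition state_dim :: "nat \<Rightarrow> nat \<Rightarrow> nat" where
  "state_dim n m = 2 * n * 2 * m"

definition basis_index :: "nat \<Rightarrow> nat \<Rightarrow> bool \<Rightarrow> nat \<Rightarrow> nat" where
  "basis_index m j b w = (2 * j + of_bool b) * m + w"

text \<open>
  The query operator for \<open>(x, y)\<close> is the permutation matrix mapping \<open>|j, b, w\<rangle>\<close> to
  \<open>|j, b XOR z\<^sub>j, w\<rangle>\<close>, where \<open>z = x @ y\<close>; thus \<open>j < n\<close> queries \<open>x ! j\<close> and
  \<open>n \<le> j\<close> queries \<open>y ! (j - n)\<close>. See \<open>query_oracle_basis\<close> below.
\<close>

definition oracle_index :: "nat \<Rightarrow> bool list \<Rightarrow> nat \<Rightarrow> nat" where
  "oracle_index m z k =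
     (let j = k div (2 * m); b = odd (k div m); w = k mod m
      in basis_index m j (b \<noteq> z ! j) w)"

definition query_oracle :: "nat \<Rightarrow> nat \<Rightarrow> bool list \<Rightarrow> bool list \<Rightarrow> complex mat" where
  "query_oracle n m x y =
     mat (state_dim n m) (state_dim n m)
       (\<lambda>(r, c). if r = oracle_index m (x @ y) c then 1 else 0)"

lemma basis_index_less:
  assumes "j < 2 * n" "w < m"
  shows "basis_index m j b w < state_dim n m"
proof -
  have "(2 * j + of_bool b) * m + w < (2 * j + of_bool b + 1) * m"
    using assms(2) by (simp add: algebra_simps)
  also have "\<dots> \<le> (2 * n * 2) * m"
    using assms(1) by (intro mult_right_mono) (cases b; simp)+
  finally show ?thesis
    by (simp add: basis_index_def state_dim_def)
qed

lemma oracle_index_basis_index: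
  assumes "w < m"
  shows "oracle_index m z (basis_index m j b w) = basis_index m j (b \<noteq> z ! j) w"
proof -
  have 1: "basis_index m j b w div m = 2 * j + of_bool b" "basis_index m j b w mod m = w"
    using assms by (simp_all add: basis_index_def)
  have "basis_index m j b w div (2 * m) = (2 * j + of_bool b) div 2"
    by (metis 1(1) div_mult2_eq mult.commute)
  then have 2: "basis_index m j b w div (2 * m) = j"
    by simp
  show ?thesis
    using 1 2 by (simp add: oracle_index_def)
qed

lemma query_oracle_basis:
  assumes "j < 2 * n" "w < m"
  shows "query_oracle n m x y *\<^sub>v unit_vec (state_dim n m) (basis_index m j b w) =
         unit_vec (state_dim n m) (basis_index m j (b \<noteq> (x @ y) ! j) w)"
proof (rule eq_vecI)
  let ?N = "state_dim n m" and ?c = "basis_index m j b w" and ?r = "basis_index m j (b \<noteq> (x @ y) ! j) w"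
  fix r
  assume "r < dim_vec (unit_vec ?N ?r :: complex vec)"
  then have r: "r < ?N"
    by simp
  have "(query_oracle n m x y *\<^sub>v unit_vec ?N ?c) $ r = row (query_oracle n m x y) r $ ?c"
    using r basis_index_less[OF assms] by (simp add: query_oracle_def)
  also have "\<dots> = (if r = ?r then 1 else 0)"
    using r basis_index_less[OF assms] assms(2)
    by (simp add: query_oracle_def oracle_index_basis_index)
  finally show "(query_oracle n m x y *\<^sub>v unit_vec ?N ?c) $ r = unit_vec ?N ?r $ r"
    using r basis_index_less[OF assms] by simp
qed (simp add: query_oracle_def)

text \<open>
  An algorithm applies input-independent unitaries \<open>U\<^sub>0, \<dots>, U\<^sub>T\<close> to the initial basis state,
  with one query between consecutive unitaries, then measures in the computational
  basis; the decision is a function of the measured basis state. Intermediate measurements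
  and classical randomness are covered by enlarging the workspace.
\<close>

record query_algorithm =
  workspace_dim :: nat
  first_unitary :: "complex mat"
  later_unitaries :: "complex mat list"
  decision :: "nat \<Rightarrow> bool"

definition query_algorithm_on :: "nat \<Rightarrow> query_algorithm \<Rightarrow> bool" where
  "query_algorithm_on n A \<longleftrightarrow>
     workspace_dim A > 0 \<and>
     unitary_mat (state_dim n (workspace_dim A)) (first_unitary A) \<and>
     (\<forall>U \<in> set (later_unitaries A). unitary_mat (state_dim n (workspace_dim A)) U)"

definition num_queries :: "query_algorithm \<Rightarrow> nat" where
  "num_queries A = length (later_unitaries A)"

definition final_state ::
    "nat \<Rightarrow> query_algorithm \<Rightarrow> bool list \<Rightarrow> bool list \<Rightarrow> complex vec" where
  "final_state n A x y =
     foldl (\<lambda>\<psi> U. U *\<^sub>v (query_oracle n (workspace_dim A) x y *\<^sub>v \<psi>))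
       (first_unitary A *\<^sub>v unit_vec (state_dim n (workspace_dim A)) 0)
       (later_unitaries A)"

definition output_prob ::
    "nat \<Rightarrow> query_algorithm \<Rightarrow> bool list \<Rightarrow> bool list \<Rightarrow> bool \<Rightarrow> real" where
  "output_prob n A x y r =
     (\<Sum>k | k < state_dim n (workspace_dim A) \<and> decision A k = r.
        (cmod (final_state n A x y $ k))\<^sup>2)"

text \<open>Output \<open>True\<close> stands for \<open>h(x, y) \<ge> a\<close> and \<open>False\<close> for \<open>h(x, y) \<le> b\<close>.\<close>

definition solves_gap_hamming :: "nat \<Rightarrow> nat \<Rightarrow> nat \<Rightarrow> query_algorithm \<Rightarrow> bool" where
  "solves_gap_hamming n a b A \<longleftrightarrow>
     (\<forall>x \<in> bit_strings n. \<forall>y \<in> bit_strings n.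
        (hamming x y \<ge> a \<longrightarrow> output_prob n A x y True \<ge> 2 / 3) \<and>
        (hamming x y \<le> b \<longrightarrow> output_prob n A x y False \<ge> 2 / 3))"

end

theory Submission
  imports Defs "HOL-Analysis.L2_Norm"
begin

text \<open>
  Hybrid argument for block sensitivity. On one fixed input, a state spreads unit mass over the
  query register, so among \<open>K\<close> disjoint blocks of positions some block
  receives total amplitude at most \<open>T / sqrt K\<close> over \<open>T\<close> queries; flipping that block moves the
  final state by at most twice this amount. For the promise problem take \<open>y = 0\<close> and flip blocks
  of \<open>g\<close> positions: zeros of a string \<open>x\<close> of weight \<open>b\<close> if \<open>b \<le> n / 2\<close>, and otherwise ones of a
  string of weight \<open>a\<close>. Either way there are at least \<open>n / 2\<close> positions to choose from.
\<close>

section \<open>Euclidean norms over sets of coordinates\<close>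

definition l2_on :: "nat set \<Rightarrow> complex vec \<Rightarrow> real" where
  "l2_on S v = L2_set (\<lambda>k. cmod (v $ k)) S"

text \<open>In the numbering by \<open>basis_index\<close>, each value of the query register owns
  \<open>2 * m\<close> consecutive indices, so \<open>k div (2 * m)\<close> is the queried
  position.\<close>

definition register_block :: "nat \<Rightarrow> nat \<Rightarrow> nat set \<Rightarrow> nat set" where
  "register_block n m B = {k. k < state_dim n m \<and> k div (2 * m) \<in> B}"

lemma l2_on_nonneg: "0 \<le> l2_on S v"
  by (simp add: l2_on_def L2_set_nonneg)

lemma l2_on_mono:
  assumes "finite T" "S \<subseteq> T"
  shows "l2_on S v \<le> l2_on T v"
  unfolding l2_on_def L2_set_def
  by (intro real_sqrt_le_mono sum_mono2) (use assms in auto)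

lemma l2_on_power2: "(l2_on S v)\<^sup>2 = (\<Sum>k\<in>S. (cmod (v $ k))\<^sup>2)"
  by (simp add: l2_on_def L2_set_def sum_nonneg)

text \<open>Minkowski's inequality. Asking only for a bound on moduli, instead of
  \<open>u = v + w\<close>, covers differences of vectors as well and leaves dimensions to the
  caller.\<close>

lemma l2_on_add:
  assumes "\<And>k. k \<in> S \<Longrightarrow> cmod (u $ k) \<le> cmod (v $ k) + cmod (w $ k)"
  shows "l2_on S u \<le> l2_on S v + l2_on S w"
proof -
  have "l2_on S u \<le> L2_set (\<lambda>k. cmod (v $ k) + cmod (w $ k)) S"
    unfolding l2_on_def by (rule L2_set_mono) (use assms in auto)
  also have "\<dots> \<le> l2_on S v + l2_on S w"
    unfolding l2_on_def by (rule L2_set_triangle_ineq)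
  finally show ?thesis .
qed

lemma l2_on_reindex:
  assumes "bij_betw f S S" "\<And>k. k \<in> S \<Longrightarrow> u $ k = v $ f k"
  shows "l2_on S u = l2_on S v"
proof -
  have "(\<Sum>k\<in>S. (cmod (u $ k))\<^sup>2) = (\<Sum>k\<in>S. (cmod (v $ f k))\<^sup>2)"
    using assms(2) by simp
  also have "\<dots> = (\<Sum>k\<in>S. (cmod (v $ k))\<^sup>2)"
    by (rule sum.reindex_bij_betw[OF assms(1)])
  finally show ?thesis
    by (simp add: l2_on_def L2_set_def)
qed

text \<open>In coordinates this is <Uv, Uv> = <U*Uv, v> = <v, v>: expand one factor of each |w_i|^2,
  exchange the sums, and recognise the inner one as an entry of U*w = v.\<close>

lemma unitary_mat_l2:
  assumes "unitary_mat N U" "v \<in> carrier_vec N"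
  shows "l2_on {..<N} (U *\<^sub>v v) = l2_on {..<N} v"
proof -
  have U: "U \<in> carrier_mat N N" and UU: "mat_adjoint U * U = 1\<^sub>m N"
    using assms(1) by (auto simp: unitary_mat_def)
  have U': "mat_adjoint U \<in> carrier_mat N N"
    using U by (auto simp: mat_adjoint_def)
  define w where "w = U *\<^sub>v v"
  have w: "w \<in> carrier_vec N"
    using U assms(2) by (auto simp: w_def)
  have "mat_adjoint U *\<^sub>v w = (mat_adjoint U * U) *\<^sub>v v"
    unfolding w_def using U U' assms(2) by (simp add: assoc_mult_mat_vec)
  then have adjoint_w: "mat_adjoint U *\<^sub>v w = v"
    using assms(2) UU by simp
  have v_j: "v $ j = (\<Sum>i<N. cnj (U $$ (i, j)) * w $ i)" if "j < N" for j
  proof -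
    have "v $ j = (mat_adjoint U *\<^sub>v w) $ j"
      by (simp add: adjoint_w)
    also have "\<dots> = (\<Sum>i<N. cnj (U $$ (i, j)) * w $ i)"
      using that U U' w by (auto simp: mat_adjoint_def scalar_prod_def lessThan_atLeast0 intro!: sum.cong)
    finally show ?thesis .
  qed
  have w_i: "w $ i = (\<Sum>j<N. U $$ (i, j) * v $ j)" if "i < N" for i
    using that U assms(2) by (auto simp: w_def scalar_prod_def lessThan_atLeast0)
  \<comment> \<open>The squared moduli are lifted to complex numbers so that they factor as z times
    its conjugate; injectivity of \<open>of_real\<close> leads back at the end.\<close>
  have "(\<Sum>i<N. complex_of_real ((cmod (w $ i))\<^sup>2)) = (\<Sum>i<N. w $ i * cnj (w $ i))"
    by (simp only: complex_norm_square)
  also have "\<dots> = (\<Sum>i<N. \<Sum>j<N. w $ i * (cnj (U $$ (i, j)) * cnj (v $ j)))"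
    by (intro sum.cong refl, subst (2) w_i) (simp_all add: sum_distrib_left)
  also have "\<dots> = (\<Sum>j<N. \<Sum>i<N. w $ i * (cnj (U $$ (i, j)) * cnj (v $ j)))"
    by (rule sum.swap)
  also have "\<dots> = (\<Sum>j<N. v $ j * cnj (v $ j))"
    by (intro sum.cong refl, subst v_j) (simp_all add: sum_distrib_left sum_distrib_right mult_ac)
  also have "\<dots> = (\<Sum>i<N. complex_of_real ((cmod (v $ i))\<^sup>2))"
    by (simp only: complex_norm_square)
  finally have "(\<Sum>i<N. (cmod (w $ i))\<^sup>2) = (\<Sum>i<N. (cmod (v $ i))\<^sup>2)"
    by (metis of_real_eq_iff of_real_sum)
  then show ?thesis
    by (simp add: l2_on_def L2_set_def w_def)
qed

section \<open>The query oracle as an index permutation\<close>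

lemma basis_index_decomp: "basis_index m (k div (2 * m)) (odd (k div m)) (k mod m) = k"
proof -
  have "2 * (k div (2 * m)) + of_bool (odd (k div m)) = k div m"
    unfolding mult.commute[of 2 m] div_mult2_eq by (simp add: of_bool_odd_eq_mod_2)
  then show ?thesis
    by (simp add: basis_index_def)
qed

lemma state_dim_iff:
  assumes "m > 0"
  shows "k < state_dim n m \<longleftrightarrow> k div (2 * m) < 2 * n"
  using assms by (simp add: state_dim_def div_less_iff_less_mult mult_ac)

text \<open>A query changes only the answer qubit. This is what makes every register block invariant
  under queries.\<close>

lemma oracle_index_div:
  assumes "m > 0"
  shows "oracle_index m z k div (2 * m) = k div (2 * m)"
proof -
  have "basis_index m j b w div (2 * m) = j" if "w < m" for j b w
  proof -
    have "basis_index m j b w div m = 2 * j + of_bool b"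
      using that by (simp add: basis_index_def)
    then have "basis_index m j b w div (m * 2) = (2 * j + of_bool b) div 2"
      by (simp add: div_mult2_eq)
    then show ?thesis
      by (simp add: mult.commute)
  qed
  then show ?thesis
    using assms by (simp add: oracle_index_def Let_def)
qed

text \<open>The same bit is XORed into the answer qubit twice and cancels.\<close>

lemma oracle_index_involution:
  assumes "m > 0"
  shows "oracle_index m z (oracle_index m z k) = k"
proof -
  let ?j = "k div (2 * m)" and ?b = "odd (k div m)" and ?w = "k mod m"
  have "oracle_index m z k = basis_index m ?j (?b \<noteq> z ! ?j) ?w"
    by (simp add: oracle_index_def Let_def)
  then have "oracle_index m z (oracle_index m z k) = basis_index m ?j ((?b \<noteq> z ! ?j) \<noteq> z ! ?j) ?w"
    using assms by (simp add: oracle_index_basis_index)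
  also have "((?b \<noteq> z ! ?j) \<noteq> z ! ?j) = ?b"
    by auto
  finally show ?thesis
    by (simp only: basis_index_decomp)
qed

lemma oracle_index_less:
  assumes "m > 0" "k < state_dim n m"
  shows "oracle_index m z k < state_dim n m"
  using assms by (simp add: state_dim_iff oracle_index_div)

lemma oracle_index_cong:
  assumes "z ! (k div (2 * m)) = z' ! (k div (2 * m))"
  shows "oracle_index m z k = oracle_index m z' k"
  using assms by (simp add: oracle_index_def)

lemma bij_betw_oracle_index:
  assumes "m > 0"
  shows "bij_betw (oracle_index m z) (register_block n m B) (register_block n m B)"
  by (rule bij_betwI[where g = "oracle_index m z"])
    (use assms in \<open>auto simp: register_block_def oracle_index_div oracle_index_less
      oracle_index_involution\<close>)

lemma register_block_all:
  assumes "m > 0"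
  shows "register_block n m {..<2 * n} = {..<state_dim n m}"
  using assms by (auto simp: register_block_def state_dim_iff)

lemma query_oracle_carrier [simp]:
  "query_oracle n m x y \<in> carrier_mat (state_dim n m) (state_dim n m)"
  by (simp add: query_oracle_def)

text \<open>A permutation matrix acts on coordinates through the inverse permutation; here the
  permutation is its own inverse.\<close>

lemma query_oracle_nth:
  assumes "m > 0" "v \<in> carrier_vec (state_dim n m)" "r < state_dim n m"
  shows "(query_oracle n m x y *\<^sub>v v) $ r = v $ oracle_index m (x @ y) r"
proof -
  let ?N = "state_dim n m" and ?f = "oracle_index m (x @ y)"
  have "(query_oracle n m x y *\<^sub>v v) $ r = (\<Sum>c = 0..<?N. (if r = ?f c then 1 else 0) * v $ c)"
    using assms by (auto simp: query_oracle_def scalar_prod_def)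
  also have "\<dots> = (\<Sum>c = 0..<?N. if c = ?f r then v $ c else 0)"
    using oracle_index_involution[OF assms(1), of "x @ y"] by (intro sum.cong) auto
  also have "\<dots> = v $ ?f r"
    using oracle_index_less[OF assms(1,3)] by simp
  finally show ?thesis .
qed

lemma query_oracle_l2:
  assumes "m > 0" "v \<in> carrier_vec (state_dim n m)"
  shows "l2_on (register_block n m B) (query_oracle n m x y *\<^sub>v v) = l2_on (register_block n m B) v"
  by (rule l2_on_reindex[OF bij_betw_oracle_index[OF assms(1), of "x @ y"]])
    (use query_oracle_nth[OF assms] in \<open>auto simp: register_block_def\<close>)

lemma query_oracle_l2_full:
  assumes "m > 0" "v \<in> carrier_vec (state_dim n m)"
  shows "l2_on {..<state_dim n m} (query_oracle n m x y *\<^sub>v v) = l2_on {..<state_dim n m} v"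
  using query_oracle_l2[OF assms, of "{..<2 * n}"] by (simp add: register_block_all assms(1))

text \<open>Outside the block both queries move amplitudes identically, so the difference vanishes
  there. Inside, the triangle inequality applies, and each query preserves the mass of the block;
  hence the factor 2.\<close>

lemma query_oracle_change:
  assumes "m > 0" "v \<in> carrier_vec (state_dim n m)"
    and agree: "\<And>j. j < 2 * n \<Longrightarrow> j \<notin> B \<Longrightarrow> (x @ y) ! j = (x' @ y') ! j"
  shows "l2_on {..<state_dim n m} (query_oracle n m x y *\<^sub>v v - query_oracle n m x' y' *\<^sub>v v)
    \<le> 2 * l2_on (register_block n m B) v"
proof -
  let ?N = "state_dim n m" and ?R = "register_block n m B"
  let ?u = "query_oracle n m x y *\<^sub>v v" and ?u' = "query_oracle n m x' y' *\<^sub>v v"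
  have dims: "dim_vec ?u = ?N" "dim_vec ?u' = ?N"
    by (simp_all add: query_oracle_def)
  have "(?u - ?u') $ k = 0" if "k < ?N" "k \<notin> ?R" for k
  proof -
    have "oracle_index m (x @ y) k = oracle_index m (x' @ y') k"
      using that assms(1) by (intro oracle_index_cong agree) (auto simp: register_block_def state_dim_iff)
    then show ?thesis
      using that dims by (simp add: query_oracle_nth[OF assms(1,2)] del: index_mult_mat_vec)
  qed
  then have "(\<Sum>k<?N. (cmod ((?u - ?u') $ k))\<^sup>2) = (\<Sum>k\<in>?R. (cmod ((?u - ?u') $ k))\<^sup>2)"
    by (intro sum.mono_neutral_right) (auto simp: register_block_def)
  then have "l2_on {..<?N} (?u - ?u') = l2_on ?R (?u - ?u')"
    by (simp add: l2_on_def L2_set_def)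
  also have "\<dots> \<le> l2_on ?R ?u + l2_on ?R ?u'"
    by (rule l2_on_add) (use dims in \<open>auto simp: register_block_def norm_triangle_ineq4\<close>)
  also have "\<dots> = 2 * l2_on ?R v"
    by (simp add: query_oracle_l2[OF assms(1,2)])
  finally show ?thesis .
qed

section \<open>Runs from an arbitrary start vector and the hybrid argument\<close>

definition run :: "nat \<Rightarrow> nat \<Rightarrow> bool list \<Rightarrow> bool list \<Rightarrow> complex vec \<Rightarrow> complex mat list \<Rightarrow> complex vec" where
  "run n m x y = foldl (\<lambda>\<psi> U. U *\<^sub>v (query_oracle n m x y *\<^sub>v \<psi>))"

lemma run_simps:
  "run n m x y v [] = v"
  "run n m x y v (U # Us) = run n m x y (U *\<^sub>v (query_oracle n m x y *\<^sub>v v)) Us"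
  by (simp_all add: run_def)

lemma run_carrier:
  assumes "\<forall>U\<in>set Us. unitary_mat (state_dim n m) U" "v \<in> carrier_vec (state_dim n m)"
  shows "run n m x y v Us \<in> carrier_vec (state_dim n m)"
  using assms
proof (induction Us arbitrary: v)
  case (Cons U Us)
  have "U *\<^sub>v (query_oracle n m x y *\<^sub>v v) \<in> carrier_vec (state_dim n m)"
    using Cons.prems by (auto simp: unitary_mat_def intro!: mult_mat_vec_carrier)
  with Cons show ?case by (auto simp: run_simps)
qed (simp add: run_simps)

lemma run_l2:
  assumes "m > 0" "\<forall>U\<in>set Us. unitary_mat (state_dim n m) U" "v \<in> carrier_vec (state_dim n m)"
  shows "l2_on {..<state_dim n m} (run n m x y v Us) = l2_on {..<state_dim n m} v"
  using assms(2,3)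
proof (induction Us arbitrary: v)
  case (Cons U Us)
  let ?w = "query_oracle n m x y *\<^sub>v v"
  have w: "?w \<in> carrier_vec (state_dim n m)"
    using Cons.prems by (auto intro!: mult_mat_vec_carrier)
  then have "U *\<^sub>v ?w \<in> carrier_vec (state_dim n m)"
    using Cons.prems by (auto simp: unitary_mat_def intro!: mult_mat_vec_carrier)
  then show ?case
    using Cons w by (simp add: run_simps unitary_mat_l2 query_oracle_l2_full[OF assms(1)])
qed (simp add: run_simps)

text \<open>Induction on the unitaries, with two start vectors because the runs have already
  diverged after one step. Only states of the run on \<open>(x, y)\<close> occur in the error sum,
  so the same states can later be tested against all blocks at once.\<close>

lemma hybrid_argument:
  assumes "m > 0" "\<forall>U\<in>set Us. unitary_mat (state_dim n m) U"
    and "v \<in> carrier_vec (state_dim n m)" "w \<in> carrier_vec (state_dim n m)"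
    and agree: "\<And>j. j < 2 * n \<Longrightarrow> j \<notin> B \<Longrightarrow> (x @ y) ! j = (x' @ y') ! j"
  shows "l2_on {..<state_dim n m} (run n m x y v Us - run n m x' y' w Us)
    \<le> l2_on {..<state_dim n m} (v - w)
      + 2 * (\<Sum>t<length Us. l2_on (register_block n m B) (run n m x y v (take t Us)))"
  using assms(2-4)
proof (induction Us arbitrary: v w)
  case (Cons U Us)
  let ?N = "state_dim n m" and ?O = "query_oracle n m x y" and ?O' = "query_oracle n m x' y'"
  let ?v = "U *\<^sub>v (?O *\<^sub>v v)" and ?w = "U *\<^sub>v (?O' *\<^sub>v w)"
  have U: "unitary_mat ?N U" "U \<in> carrier_mat ?N ?N"
    using Cons.prems by (auto simp: unitary_mat_def)
  note v = \<open>v \<in> carrier_vec ?N\<close> and w = \<open>w \<in> carrier_vec ?N\<close>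
  have O: "?O *\<^sub>v v \<in> carrier_vec ?N" "?O' *\<^sub>v v \<in> carrier_vec ?N" "?O' *\<^sub>v w \<in> carrier_vec ?N"
    using v w by (auto intro!: mult_mat_vec_carrier)
  have vw: "?v \<in> carrier_vec ?N" "?w \<in> carrier_vec ?N"
    using O U by (auto intro!: mult_mat_vec_carrier)
  have "?v - ?w = U *\<^sub>v (?O *\<^sub>v v - ?O' *\<^sub>v w)"
    using mult_minus_distrib_mat_vec[OF U(2) O(1,3)] by simp
  then have "l2_on {..<?N} (?v - ?w) = l2_on {..<?N} (?O *\<^sub>v v - ?O' *\<^sub>v w)"
    using O by (simp add: unitary_mat_l2[OF U(1)])
  \<comment> \<open>The intermediate vector separates the two errors: first the oracle changes on
    the same state \<open>v\<close>, then the same isometry \<open>?O'\<close> acts on the old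
    difference \<open>v - w\<close>.\<close>
  also have "\<dots> \<le> l2_on {..<?N} (?O *\<^sub>v v - ?O' *\<^sub>v v) + l2_on {..<?N} (?O' *\<^sub>v v - ?O' *\<^sub>v w)"
  proof (rule l2_on_add)
    fix k assume "k \<in> {..<?N}"
    then have "(?O *\<^sub>v v - ?O' *\<^sub>v w) $ k = (?O *\<^sub>v v - ?O' *\<^sub>v v) $ k + (?O' *\<^sub>v v - ?O' *\<^sub>v w) $ k"
      using O by (simp add: query_oracle_def)
    then show "cmod ((?O *\<^sub>v v - ?O' *\<^sub>v w) $ k)
      \<le> cmod ((?O *\<^sub>v v - ?O' *\<^sub>v v) $ k) + cmod ((?O' *\<^sub>v v - ?O' *\<^sub>v w) $ k)"
      by (simp add: norm_triangle_ineq)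
  qed
  also have "?O' *\<^sub>v v - ?O' *\<^sub>v w = ?O' *\<^sub>v (v - w)"
    by (simp add: mult_minus_distrib_mat_vec[OF query_oracle_carrier v w])
  also have "l2_on {..<?N} (?O' *\<^sub>v (v - w)) = l2_on {..<?N} (v - w)"
    using v w by (simp add: query_oracle_l2_full[OF assms(1)])
  finally have step: "l2_on {..<?N} (?v - ?w)
      \<le> 2 * l2_on (register_block n m B) v + l2_on {..<?N} (v - w)"
    using query_oracle_change[OF assms(1) v agree] by force
  have "l2_on {..<?N} (run n m x y ?v Us - run n m x' y' ?w Us)
    \<le> l2_on {..<?N} (?v - ?w)
      + 2 * (\<Sum>t<length Us. l2_on (register_block n m B) (run n m x y ?v (take t Us)))"
    using Cons vw by simp
  \<comment> \<open>The new error term is the summand \<open>t = 0\<close>, the state just before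
    the first query; the remaining summands are shifted by one.\<close>
  then show ?case
    using step by (simp add: run_simps sum.lessThan_Suc_shift del: sum.lessThan_Suc)
qed (simp add: run_simps)

text \<open>Cauchy--Schwarz over the blocks: disjoint blocks share the unit mass of a state.\<close>

lemma sum_l2_on_blocks:
  assumes disj: "disjoint_family_on B I" and I: "finite I"
  shows "(\<Sum>i\<in>I. l2_on (register_block n m (B i)) v)
    \<le> sqrt (card I) * l2_on {..<state_dim n m} v"
proof -
  let ?R = "\<lambda>i. register_block n m (B i)"
  have "(\<Sum>i\<in>I. 1 * l2_on (?R i) v) \<le> L2_set (\<lambda>i. 1) I * L2_set (\<lambda>i. l2_on (?R i) v) I"
    using L2_set_mult_ineq[of "\<lambda>i. 1" "\<lambda>i. l2_on (?R i) v" I] by (simp add: l2_on_nonneg)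
  also have "L2_set (\<lambda>i. l2_on (?R i) v) I = l2_on (\<Union>i\<in>I. ?R i) v"
  proof -
    have "(\<Sum>i\<in>I. \<Sum>k\<in>?R i. (cmod (v $ k))\<^sup>2) = (\<Sum>k\<in>(\<Union>i\<in>I. ?R i). (cmod (v $ k))\<^sup>2)"
      by (rule sum.UNION_disjoint[symmetric])
        (use disj I in \<open>auto simp: register_block_def disjoint_family_on_def\<close>)
    then show ?thesis
      unfolding L2_set_def l2_on_power2 by (simp add: l2_on_def L2_set_def)
  qed
  also have "\<dots> \<le> l2_on {..<state_dim n m} v"
    by (rule l2_on_mono) (auto simp: register_block_def)
  finally show ?thesis
    by (simp add: L2_set_def mult_left_mono)
qed

section \<open>From success probabilities to the block sensitivity bound\<close>

lemma final_state_run: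
  "final_state n A x y = run n (workspace_dim A) x y
     (first_unitary A *\<^sub>v unit_vec (state_dim n (workspace_dim A)) 0) (later_unitaries A)"
  by (simp add: final_state_def run_def)

text \<open>With a final state of norm 1, this turns success on a flipped input into an upper bound
  of 1/3 on the probability of the opposite answer.\<close>

lemma output_prob_add_not:
  "output_prob n A x y r + output_prob n A x y (\<not> r)
    = (l2_on {..<state_dim n (workspace_dim A)} (final_state n A x y))\<^sup>2"
proof -
  let ?N = "state_dim n (workspace_dim A)"
  have "{..<?N} = {k. k < ?N \<and> decision A k = r} \<union> {k. k < ?N \<and> decision A k = (\<not> r)}"
    by auto
  then have "(l2_on {..<?N} (final_state n A x y))\<^sup>2
      = (\<Sum>k\<in>{k. k < ?N \<and> decision A k = r} \<union> {k. k < ?N \<and> decision A k = (\<not> r)}.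
          (cmod (final_state n A x y $ k))\<^sup>2)"
    by (simp add: l2_on_power2)
  also have "\<dots> = output_prob n A x y r + output_prob n A x y (\<not> r)"
    unfolding output_prob_def by (rule sum.union_disjoint) auto
  finally show ?thesis by simp
qed

text \<open>The distance in amplitude between acceptance probabilities 2/3 and 1/3, rounded down
  through 16/25 < 2/3 and 1/3 < 9/25.\<close>

lemma sqrt_gap: "1 / 5 \<le> sqrt (2 / 3) - sqrt (1 / 3 :: real)"
proof -
  have "sqrt (1 / 3 :: real) \<le> 3 / 5"
    by (rule real_le_lsqrt) (simp_all add: power2_eq_square)
  moreover have "4 / 5 \<le> sqrt (2 / 3 :: real)"
    by (rule real_le_rsqrt) (simp add: power2_eq_square)
  ultimately show ?thesis by linarith
qed

text \<open>Instead of selecting a lightest block, the hybrid bounds are summed over all blocks.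
  With K blocks and T queries this gives K / 5 \<le> 2 T sqrt K, hence the constant 10.\<close>

lemma block_sensitivity_bound:
  assumes n: "n \<ge> 1" and A: "query_algorithm_on n A"
    and disj: "disjoint_family_on B I" and I: "finite I"
    and agree: "\<And>i j. i \<in> I \<Longrightarrow> j < 2 * n \<Longrightarrow> j \<notin> B i \<Longrightarrow> (x @ y) ! j = (x' i @ y' i) ! j"
    and base: "output_prob n A x y r \<ge> 2 / 3"
    and flipped: "\<And>i. i \<in> I \<Longrightarrow> output_prob n A (x' i) (y' i) (\<not> r) \<ge> 2 / 3"
  shows "sqrt (card I) \<le> 10 * num_queries A"
proof -
  define m where "m = workspace_dim A"
  define N where "N = state_dim n m"
  define Us where "Us = later_unitaries A"
  define v where "v = first_unitary A *\<^sub>v unit_vec N 0"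
  have m: "m > 0" and U0: "unitary_mat N (first_unitary A)"
    and Us: "\<forall>U\<in>set Us. unitary_mat (state_dim n m) U"
    using A by (auto simp: query_algorithm_on_def m_def N_def Us_def)
  have v: "v \<in> carrier_vec (state_dim n m)"
    using U0 by (auto simp: v_def N_def unitary_mat_def intro!: mult_mat_vec_carrier)
  have "N > 0"
    using m n by (simp add: N_def state_dim_def)
  have "(\<Sum>k<N. (cmod (unit_vec N 0 $ k))\<^sup>2) = (\<Sum>k<N. if k = 0 then 1 else 0)"
    by (intro sum.cong) auto
  then have "l2_on {..<N} (unit_vec N 0) = 1"
    using \<open>N > 0\<close> by (simp add: l2_on_def L2_set_def)
  then have v1: "l2_on {..<N} v = 1"
    by (simp add: v_def unitary_mat_l2[OF U0])
  have final: "final_state n A s t = run n m s t v Us" for s t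
    by (simp add: final_state_run m_def N_def Us_def v_def)
  have final1: "l2_on {..<N} (final_state n A s t) = 1" for s t
    using run_l2[OF m Us v] v1 by (simp add: final N_def)
  \<comment> \<open>The probability of answer \<open>r\<close> is the squared norm on
    \<open>S\<close>, so the triangle inequality on \<open>S\<close> compares the two final states
    directly.\<close>
  define S where "S = {k. k < N \<and> decision A k = r}"
  have prob: "output_prob n A s t r = (l2_on S (final_state n A s t))\<^sup>2" for s t
    by (simp add: output_prob_def l2_on_power2 S_def N_def m_def)
  have far: "1 / 5 \<le> 2 * (\<Sum>t<length Us. l2_on (register_block n m (B i)) (run n m x y v (take t Us)))"
    if i: "i \<in> I" for i
  proof -
    let ?\<psi> = "final_state n A x y" and ?\<phi> = "final_state n A (x' i) (y' i)"
    have "sqrt (2 / 3) \<le> l2_on S ?\<psi>"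
      using base by (intro real_le_lsqrt) (auto simp: prob l2_on_nonneg)
    moreover have "output_prob n A (x' i) (y' i) r \<le> 1 / 3"
      using output_prob_add_not[of n A "x' i" "y' i" r] flipped[OF i] final1
      by (simp add: N_def m_def)
    then have "l2_on S ?\<phi> \<le> sqrt (1 / 3)"
      by (intro real_le_rsqrt) (simp add: prob)
    moreover have "l2_on S ?\<psi> \<le> l2_on S ?\<phi> + l2_on S (?\<psi> - ?\<phi>)"
    proof (rule l2_on_add)
      fix k assume "k \<in> S"
      then have "(?\<psi> - ?\<phi>) $ k = ?\<psi> $ k - ?\<phi> $ k"
        by (simp add: S_def final N_def carrier_vecD[OF run_carrier[OF Us v]])
      then show "cmod (?\<psi> $ k) \<le> cmod (?\<phi> $ k) + cmod ((?\<psi> - ?\<phi>) $ k)"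
        by (simp add: norm_triangle_sub)
    qed
    moreover have "l2_on S (?\<psi> - ?\<phi>) \<le> l2_on {..<N} (?\<psi> - ?\<phi>)"
      by (rule l2_on_mono) (auto simp: S_def)
    moreover have "l2_on {..<N} (?\<psi> - ?\<phi>)
      \<le> l2_on {..<N} (v - v)
        + 2 * (\<Sum>t<length Us. l2_on (register_block n m (B i)) (run n m x y v (take t Us)))"
      unfolding final N_def by (rule hybrid_argument[OF m Us v v agree[OF i]])
    moreover have "l2_on {..<N} (v - v) = 0"
      using v by (simp add: l2_on_def L2_set_def N_def)
    ultimately show ?thesis
      using sqrt_gap by linarith
  qed
  have "card I * (1 / 5 :: real) = (\<Sum>i\<in>I. 1 / 5)"
    by simp
  also have "\<dots> \<le> (\<Sum>i\<in>I. 2 * (\<Sum>t<length Us. l2_on (register_block n m (B i)) (run n m x y v (take t Us))))"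
    by (rule sum_mono) (rule far)
  \<comment> \<open>After the exchange, each time step contributes one unit state split over
    disjoint blocks, to which Cauchy-Schwarz applies.\<close>
  also have "\<dots> = 2 * (\<Sum>t<length Us. \<Sum>i\<in>I. l2_on (register_block n m (B i)) (run n m x y v (take t Us)))"
    by (simp add: sum_distrib_left[symmetric] sum.swap[of _ I])
  also have "\<dots> \<le> 2 * (\<Sum>t<length Us. sqrt (card I))"
  proof (intro mult_left_mono sum_mono)
    fix t
    have "\<forall>U\<in>set (take t Us). unitary_mat (state_dim n m) U"
      using Us by (meson in_set_takeD)
    then have "l2_on {..<state_dim n m} (run n m x y v (take t Us)) = 1"
      using run_l2[OF m _ v] v1 by (simp add: N_def)
    then show "(\<Sum>i\<in>I. l2_on (register_block n m (B i)) (run n m x y v (take t Us))) \<le> sqrt (card I)"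
      using sum_l2_on_blocks[OF disj I, of n m "run n m x y v (take t Us)"] by simp
  qed simp
  finally have main: "sqrt (card I) * sqrt (card I) \<le> (10 * num_queries A) * sqrt (card I)"
    by (simp add: num_queries_def Us_def)
  show ?thesis
  proof (cases "card I = 0")
    case False
    then have "sqrt (card I) > 0" by simp
    with main show ?thesis
      by (simp only: mult_le_cancel_right_pos)
  qed simp
qed

section \<open>Flipping consecutive blocks in the gap Hamming problem\<close>

lemma disjoint_family_on_consecutive:
  "disjoint_family_on (\<lambda>i. {c + i * g..<c + Suc i * g :: nat}) I"
proof -
  have "{c + i * g..<c + Suc i * g} \<inter> {c + j * g..<c + Suc j * g} = {}" if "i < j" for i j
  proof -
    have "Suc i * g \<le> j * g"
      using that by (intro mult_right_mono) auto
    then show ?thesis by auto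
  qed
  then show ?thesis
    unfolding disjoint_family_on_def by (metis Int_commute linorder_neqE_nat)
qed

lemma consecutive_block_le:
  assumes "i < s div (g::nat)"
  shows "Suc i * g \<le> s"
proof -
  have "Suc i * g \<le> s div g * g"
    using assms by (intro mult_right_mono) auto
  then show ?thesis
    using div_times_less_eq_dividend[of s g] by linarith
qed

lemma hamming_map_replicate_False:
  "hamming (map P [0..<n]) (replicate n False) = card {i. i < n \<and> P i}"
  unfolding hamming_def by (intro arg_cong[of _ _ card]) auto

text \<open>Against the all-\<open>False\<close> string, Hamming distance is weight. Flips are
  written as XOR with block membership, so one lemma serves both for turning zeros into ones and for
  the reverse. The string \<open>y\<close> stays fixed.\<close>

lemma block_flip_bound:
  assumes "n \<ge> 1" "query_algorithm_on n A"
    and "output_prob n A (map (\<lambda>j. j < w) [0..<n]) (replicate n False) r \<ge> 2 / 3"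
    and "\<And>i. i < s div g \<Longrightarrow>
      output_prob n A (map (\<lambda>j. (j < w) \<noteq> (j \<in> {c + i * g..<c + Suc i * g})) [0..<n])
        (replicate n False) (\<not> r) \<ge> 2 / 3"
  shows "sqrt (s div g) \<le> 10 * num_queries A"
proof -
  let ?B = "\<lambda>i. {c + i * g..<c + Suc i * g}"
  have "sqrt (card {..<s div g}) \<le> 10 * num_queries A"
  proof (rule block_sensitivity_bound[OF assms(1,2) disjoint_family_on_consecutive _ _ assms(3)])
    show "output_prob n A (map (\<lambda>j. (j < w) \<noteq> (j \<in> ?B i)) [0..<n]) (replicate n False) (\<not> r) \<ge> 2 / 3"
      if "i \<in> {..<s div g}" for i
      using assms(4) that by blast
    show "(map (\<lambda>j. j < w) [0..<n] @ replicate n False) ! j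
        = (map (\<lambda>j. (j < w) \<noteq> (j \<in> ?B i)) [0..<n] @ replicate n False) ! j"
      if "j \<notin> ?B i" for i j
      using that by (auto simp: nth_append)
  qed simp
  then show ?thesis by simp
qed

text \<open>The base string has weight \<open>b\<close>. Each block lies in its \<open>n - b\<close>
  zeros, and flipping \<open>a - b\<close> of them raises the weight to exactly
  \<open>a\<close>.\<close>

lemma gap_hamming_zeros_bound:
  assumes n: "n \<ge> 1" and A: "query_algorithm_on n A" "solves_gap_hamming n a b A"
    and ab: "b < a" "a \<le> n"
  shows "sqrt ((n - b) div (a - b)) \<le> 10 * num_queries A"
proof (rule block_flip_bound[OF n A(1), where r = False and w = b and c = b])
  have "{j. j < n \<and> j < b} = {..<b}"
    using ab by auto
  then have "hamming (map (\<lambda>j. j < b) [0..<n]) (replicate n False) \<le> b"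
    by (simp add: hamming_map_replicate_False)
  then show "output_prob n A (map (\<lambda>j. j < b) [0..<n]) (replicate n False) False \<ge> 2 / 3"
    using A(2) unfolding solves_gap_hamming_def by (auto simp: bit_strings_def)
next
  fix i assume "i < (n - b) div (a - b)"
  let ?B = "{b + i * (a - b)..<b + Suc i * (a - b)}"
  have "b + Suc i * (a - b) \<le> n"
    using consecutive_block_le[OF \<open>i < _\<close>] ab by linarith
  then have "{j. j < n \<and> (j < b) \<noteq> (j \<in> ?B)} = {..<b} \<union> ?B"
    using ab by auto
  also have "card \<dots> = card {..<b} + card ?B"
    by (rule card_Un_disjoint) auto
  also have "\<dots> = a"
    using ab by simp
  finally have "a \<le> hamming (map (\<lambda>j. (j < b) \<noteq> (j \<in> ?B)) [0..<n]) (replicate n False)"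
    by (simp only: hamming_map_replicate_False)
  then show "output_prob n A (map (\<lambda>j. (j < b) \<noteq> (j \<in> ?B)) [0..<n])
      (replicate n False) (\<not> False) \<ge> 2 / 3"
    using A(2) unfolding solves_gap_hamming_def by (auto simp: bit_strings_def)
qed

text \<open>The dual case: the base string has weight \<open>a\<close>, and erasing a block of
  \<open>a - b\<close> ones lowers the weight to exactly \<open>b\<close>.\<close>

lemma gap_hamming_ones_bound:
  assumes n: "n \<ge> 1" and A: "query_algorithm_on n A" "solves_gap_hamming n a b A"
    and ab: "b < a" "a \<le> n"
  shows "sqrt (a div (a - b)) \<le> 10 * num_queries A"
proof (rule block_flip_bound[OF n A(1), where r = True and w = a and c = 0])
  have "{j. j < n \<and> j < a} = {..<a}"
    using ab by auto
  then have "a \<le> hamming (map (\<lambda>j. j < a) [0..<n]) (replicate n False)"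
    by (simp add: hamming_map_replicate_False)
  then show "output_prob n A (map (\<lambda>j. j < a) [0..<n]) (replicate n False) True \<ge> 2 / 3"
    using A(2) unfolding solves_gap_hamming_def by (auto simp: bit_strings_def)
next
  fix i assume "i < a div (a - b)"
  let ?B = "{0 + i * (a - b)..<0 + Suc i * (a - b)}"
  have B: "?B \<subseteq> {..<a}"
    using consecutive_block_le[OF \<open>i < _\<close>] by auto
  then have "{j. j < n \<and> (j < a) \<noteq> (j \<in> ?B)} = {..<a} - ?B"
    using ab by auto
  also have "card \<dots> = card {..<a} - card ?B"
    using B by (intro card_Diff_subset) auto
  also have "\<dots> = b"
    using ab by simp
  finally have "hamming (map (\<lambda>j. (j < a) \<noteq> (j \<in> ?B)) [0..<n]) (replicate n False) \<le> b"
    by (simp only: hamming_map_replicate_False)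
  then show "output_prob n A (map (\<lambda>j. (j < a) \<noteq> (j \<in> ?B)) [0..<n])
      (replicate n False) (\<not> True) \<ge> 2 / 3"
    using A(2) unfolding solves_gap_hamming_def by (auto simp: bit_strings_def)
qed

text \<open>Rounding down a quotient that is at least 1 loses at most a factor 2, and
  \<open>n \<le> 2 * s\<close> costs another; the root of 4 is the factor 2.\<close>

lemma sqrt_div_le:
  assumes "0 < g" "g \<le> s" "n \<le> 2 * s"
  shows "sqrt (real n / real g) \<le> 2 * sqrt (s div g)"
proof -
  have "1 \<le> s div g"
    using assms by (simp add: Suc_le_eq div_greater_zero_iff)
  moreover have "s < (s div g + 1) * g"
    using assms dividend_less_div_times[of g s] by (simp add: algebra_simps)
  moreover have "(s div g + 1) * g \<le> (2 * (s div g)) * g"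
    using calculation(1) by (intro mult_right_mono) auto
  ultimately have "n \<le> 4 * (s div g) * g"
    using assms by linarith
  then have "real n \<le> 4 * real (s div g) * real g"
    by (metis of_nat_le_iff of_nat_mult of_nat_numeral)
  then have "real n / real g \<le> 4 * real (s div g)"
    using assms by (simp add: divide_le_eq)
  then have "sqrt (real n / real g) \<le> sqrt (4 * real (s div g))"
    by (rule real_sqrt_le_mono)
  then show ?thesis
    by (simp add: real_sqrt_mult)
qed

theorem theorem1:
  shows "\<exists>c::real. c > 0 \<and>
    (\<forall>(n::nat) (a::nat) (b::nat) (g::nat) (A::query_algorithm).
       n \<ge> 1 \<longrightarrow> b < a \<longrightarrow> a \<le> n \<longrightarrow> g = a - b \<longrightarrow>
       query_algorithm_on n A \<longrightarrow> solves_gap_hamming n a b A \<longrightarrow>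
       real (num_queries A) \<ge> c * sqrt (real n / real g))"
proof (intro exI[of _ "1 / 20 :: real"] conjI allI impI)
  fix n a b g :: nat and A :: query_algorithm
  assume *: "n \<ge> 1" "b < a" "a \<le> n" "g = a - b" "query_algorithm_on n A" "solves_gap_hamming n a b A"
  \<comment> \<open>The constant 20 is the 10 of the block sensitivity bound times the 2 lost in
    \<open>sqrt_div_le\<close>.\<close>
  have "sqrt (real n / real g) \<le> 20 * num_queries A"
  proof (cases "2 * b \<le> n")
    case True
    \<comment> \<open>Here \<open>s = n - b\<close>: it is at least \<open>g\<close> because
      \<open>a \<le> n\<close>, and at least half of \<open>n\<close> by the case
      assumption.\<close>
    have "sqrt (real n / real g) \<le> 2 * sqrt ((n - b) div g)"
      using * True by (intro sqrt_div_le) auto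
    also have "\<dots> \<le> 20 * num_queries A"
      using gap_hamming_zeros_bound[OF *(1,5,6,2,3)] * by simp
    finally show ?thesis .
  next
    case False
    \<comment> \<open>Here \<open>s = a\<close>, which exceeds \<open>b\<close> and so more than
      half of \<open>n\<close>.\<close>
    have "sqrt (real n / real g) \<le> 2 * sqrt (a div g)"
      using * False by (intro sqrt_div_le) auto
    also have "\<dots> \<le> 20 * num_queries A"
      using gap_hamming_ones_bound[OF *(1,5,6,2,3)] * by simp
    finally show ?thesis .
  qed
  then show "1 / 20 * sqrt (real n / real g) \<le> real (num_queries A)"
    by simp
qed simp

end
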